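(* Run the two-step-size restarted subgradient algorithm described in the context (with $B=1/\sqrt{e}$, $F=\sqrt{e}$, $\bar\varepsilon'=0.9$) on the problem $f^*=\min_{x\in Q}f(x)$ from $x^0\in Q$ with input $\varepsilon'>0$, where $f$ is convex and Lipschitz with constant $M$, $f_{\mathrm{slb}}<f^*$ is a strict lower bound, and $G$ is the growth constant. Within a total number of iterates computed that does not exceed $$18M^2G^2\left(2.7\ln\left(1+\frac{f(x^0)-f^*}{f^*-f_{\mathrm{slb}}}\right)+\left(\frac{1+\varepsilon'}{\varepsilon'}\right)^2\right),$$ the algorithm will compute an iterate $x_{i,j}$ for which $$\frac{f(x_{i,j})-f^*}{f^*-f_{\mathrm{slb}}}\le\varepsilon'.$$
   Context: Setting. $Q\subseteq\mathbb{R}^n$ is closed and convex, $f$ is real-valued and convex on $Q$, and $f^*=\min_{x\in Q}f(x)$ is attained; $\mathrm{Opt}:=\{x\in Q:f(x)=f^*\}$. The norm is Euclidean, $\mathrm{Dist}(x,S):=\min_{y\in S}\|x-y\|$, and $\Pi_Q$ is Euclidean projection onto $Q$. A number $f_{\mathrm{slb}}<f^*$ is given, and the growth constant is $G:=\sup_{x\in Q}\mathrm{Dist}(x,\mathrm{Opt})/(f(x)-f_{\mathrm{slb}})$, assumed finite. $f$ satisfies $|f(y)-f(x)|\le M\|y-x\|$ for all $x,y$ in a relatively open set $\hat Q\supseteq Q$. A subgradient of $f$ at $x\in Q$ is a $g$ with $f(y)\ge f(x)+g^T(y-x)$ for all $y\in Q$; all subgradients used satisfy $\|g\|\le M$. Subgradient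 step: from $x\in Q$ with subgradient $g$ and step-size $\alpha$, the next point is $\Pi_Q(x-\alpha g)$. If $g=0$ (so $x$ is optimal) the point is left unchanged. Algorithm. Input $x^0\in Q$ and $\varepsilon'>0$; constants $B,F,\bar\varepsilon'$; set $\varepsilon:=\varepsilon'/(1+\varepsilon')$ and $\bar\varepsilon:=\bar\varepsilon'/(1+\bar\varepsilon')$. Set $x_{1,0}=\bar x_{1,0}=x^0$. At outer iteration $i=1,2,\dots$ (where $x_{i,0}=\bar x_{i,0}$) set $K_i=+\infty$ and, for inner iterations $j=0,1,2,\dots$: if $\frac{f(x_{i,j})-f_{\mathrm{slb}}}{f(x_{i,0})-f_{\mathrm{slb}}}\ge B$ and $\frac{f(\bar x_{i,j})-f_{\mathrm{slb}}}{f(x_{i,0})-f_{\mathrm{slb}}}\ge B$, choose subgradients $g_{ij}$ at $x_{i,j}$ and $\bar g_{ij}$ at $\bar x_{i,j}$, and let $x_{i,j+1}$ and $\bar x_{i,j+1}$ be the results of subgradient steps from $x_{i,j}$ and $\bar x_{i,j}$ with step-sizes $\alpha_{ij}=\frac{\varepsilon(f(x_{i,0})-f_{\mathrm{slb}})}{F\|g_{ij}\|^2}$ and $\bar\alpha_{ij}=\frac{\bar\varepsilon(f(\bar x_{i,0})-f_{\mathrm{slb}})}{F\|\bar g_{ij}\|^2}$ respectively, and continue with $j+1$. Otherwise set $K_i=j$, set $x_{i+1,0}=\bar x_{i+1,0}$ equal to $x_{i,j}$ if $\frac{f(x_{i,j})-f_{\mathrm{slb}}}{f(x_{i,0})-f_{\mathrm{slb}}}<B$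 and equal to $\bar x_{i,j}$ otherwise, and start outer iteration $i+1$. The algorithm runs indefinitely. Counting: an iterate is computed each time a subgradient is computed and a subgradient step is taken, so two iterates are computed per inner iteration; the initial points $x_{i,0}$ are not counted anew. *)

theory Defs
  imports "HOL-Analysis.Analysis" "HOL-Library.Extended_Nat"
begin

definition is_min_value :: "('a \<Rightarrow> real) \<Rightarrow> 'a set \<Rightarrow> real \<Rightarrow> bool" where
  "is_min_value f Q m \<longleftrightarrow> m \<in> f ` Q \<and> (\<forall>x\<in>Q. m \<le> f x)"

definition opt_set :: "('a \<Rightarrow> real) \<Rightarrow> 'a set \<Rightarrow> real \<Rightarrow> 'a set" where
  "opt_set f Q fstar = {x \<in> Q. f x = fstar}"

text \<open>
  \<^term>\<open>infdist x S\<close> is the minimum of the distances from \<open>x\<close> to points of \<open>S\<close> when \<open>S\<close> is closed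
  and nonempty, as the set of minimizers is below.
\<close>

definition growth_ratios ::
    "('a::euclidean_space \<Rightarrow> real) \<Rightarrow> 'a set \<Rightarrow> real \<Rightarrow> real \<Rightarrow> real set" where
  "growth_ratios f Q fstar fslb =
     (\<lambda>x. infdist x (opt_set f Q fstar) / (f x - fslb)) ` Q"

text \<open>As a real-valued supremum, this is the intended value only if the set of ratios is bounded above.\<close>

definition growth_const ::
    "('a::euclidean_space \<Rightarrow> real) \<Rightarrow> 'a set \<Rightarrow> real \<Rightarrow> real \<Rightarrow> real" where
  "growth_const f Q fstar fslb = Sup (growth_ratios f Q fstar fslb)"

definition is_subgradient ::
    "('a::euclidean_space \<Rightarrow> real) \<Rightarrow> 'a set \<Rightarrow> 'a \<Rightarrow> 'a \<Rightarrow> bool" where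
  "is_subgradient f Q x g \<longleftrightarrow> x \<in> Q \<and> (\<forall>y\<in>Q. f y \<ge> f x + g \<bullet> (y - x))"

definition subgrad_step :: "'a::euclidean_space set \<Rightarrow> 'a \<Rightarrow> 'a \<Rightarrow> real \<Rightarrow> 'a" where
  "subgrad_step Q x g \<alpha> = (if g = 0 then x else closest_point Q (x - \<alpha> *\<^sub>R g))"

text \<open>
  A run is given by the doubly indexed points \<open>x i j\<close>, \<open>xb i j\<close>, the chosen subgradients
  \<open>g i j\<close>, \<open>gb i j\<close>, and the lengths \<open>K i\<close> of the outer iterations, where \<open>i \<ge> 1\<close>.  If an outer
  iteration never ends (\<open>K i = \<infinity>\<close>), no later one is started, and the entries of \<open>x\<close>, \<open>xb\<close>, \<open>g\<close>,
  \<open>gb\<close> and \<open>K\<close> that the algorithm never reaches are unconstrained.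
\<close>

definition outer_started :: "(nat \<Rightarrow> enat) \<Rightarrow> nat \<Rightarrow> bool" where
  "outer_started K i \<longleftrightarrow> i \<ge> 1 \<and> (\<forall>i'\<in>{1..<i}. K i' \<noteq> \<infinity>)"

definition point_reached :: "(nat \<Rightarrow> enat) \<Rightarrow> nat \<Rightarrow> nat \<Rightarrow> bool" where
  "point_reached K i j \<longleftrightarrow> outer_started K i \<and> enat j \<le> K i"

definition step_performed :: "(nat \<Rightarrow> enat) \<Rightarrow> nat \<Rightarrow> nat \<Rightarrow> bool" where
  "step_performed K i j \<longleftrightarrow> outer_started K i \<and> enat j < K i"

definition continues ::
    "('a \<Rightarrow> real) \<Rightarrow> real \<Rightarrow> real \<Rightarrow> (nat \<Rightarrow> nat \<Rightarrow> 'a) \<Rightarrow> (nat \<Rightarrow> nat \<Rightarrow> 'a) \<Rightarrow> nat \<Rightarrow> nat \<Rightarrow> bool" where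
  "continues f fslb B x xb i j \<longleftrightarrow>
     (f (x i j) - fslb) / (f (x i 0) - fslb) \<ge> B \<and>
     (f (xb i j) - fslb) / (f (x i 0) - fslb) \<ge> B"

definition is_run ::
    "('a::euclidean_space \<Rightarrow> real) \<Rightarrow> 'a set \<Rightarrow> real \<Rightarrow> real \<Rightarrow> real \<Rightarrow> real \<Rightarrow> real \<Rightarrow> 'a \<Rightarrow>
     (nat \<Rightarrow> nat \<Rightarrow> 'a) \<Rightarrow> (nat \<Rightarrow> nat \<Rightarrow> 'a) \<Rightarrow> (nat \<Rightarrow> nat \<Rightarrow> 'a) \<Rightarrow> (nat \<Rightarrow> nat \<Rightarrow> 'a) \<Rightarrow>
     (nat \<Rightarrow> enat) \<Rightarrow> bool" where
  "is_run f Q fslb B F eps' epsb' x0 x xb g gb K \<longleftrightarrow>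
     (let eps = eps' / (1 + eps'); epsb = epsb' / (1 + epsb') in
       x 1 0 = x0 \<and> xb 1 0 = x0 \<and>
       (\<forall>i j. step_performed K i j \<longrightarrow>
          continues f fslb B x xb i j \<and>
          is_subgradient f Q (x i j) (g i j) \<and>
          is_subgradient f Q (xb i j) (gb i j) \<and>
          x i (Suc j) = subgrad_step Q (x i j) (g i j)
            (eps * (f (x i 0) - fslb) / (F * (norm (g i j))\<^sup>2)) \<and>
          xb i (Suc j) = subgrad_step Q (xb i j) (gb i j)
            (epsb * (f (xb i 0) - fslb) / (F * (norm (gb i j))\<^sup>2))) \<and>
       (\<forall>i k. outer_started K i \<longrightarrow> K i = enat k \<longrightarrow>
          \<not> continues f fslb B x xb i k \<and>
          x (Suc i) 0 = (if (f (x i k) - fslb) / (f (x i 0) - fslb) < B then x i k else xb i k) \<and>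
          xb (Suc i) 0 = x (Suc i) 0))"

text \<open>
  Number of iterates computed up to the point at which \<open>x i j\<close> and \<open>xb i j\<close> are available: each
  inner iteration computes two, and the initial points of outer iterations are not counted.
\<close>

definition iterates_computed :: "(nat \<Rightarrow> enat) \<Rightarrow> nat \<Rightarrow> nat \<Rightarrow> nat" where
  "iterates_computed K i j = (\<Sum>i'\<in>{1..<i}. 2 * the_enat (K i')) + 2 * j"

end

theory Submission
  imports Defs
begin

text \<open>
  Write \<open>h x = f x - fslb\<close> and \<open>h* = fstar - fslb\<close>.  As long as the current iterate of a subgradient
  sequence is not \<open>\<epsilon>'\<close>-optimal and has \<open>h \<ge> h\<^sub>0 / F\<close>, each step lowers the squared distance to a
  fixed minimizer by at least \<open>(\<epsilon> h\<^sub>0 / (F M))\<^sup>2\<close>, while the initial distance is at most \<open>G h\<^sub>0\<close>; so an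
  outer iteration takes at most \<open>(F M G / \<epsilon>)\<^sup>2\<close> inner steps.  The fixed accuracy \<open>\<epsilon>\<close>-bar gives a
  bound independent of \<open>\<epsilon>\<close> for every outer iteration whose second sequence stays away from accuracy
  \<open>0.9\<close>.  Since \<open>h\<close> shrinks by the factor \<open>F\<close> per restart and stays above \<open>h*\<close>, there are at most
  \<open>ln (h x\<^sub>0 / h*) / ln F\<close> of these; and from the first of the other outer iterations on, \<open>h\<close> is at
  most \<open>1.9 F h*\<close>, which leaves room for only three.
\<close>

section \<open>Subgradient steps\<close>

text \<open>Projection onto \<open>Q\<close> is nonexpansive and fixes \<open>z\<close>, so it is
  enough to expand the square for the unprojected step; the subgradient inequality at
  \<open>z\<close> controls the cross term.\<close>

lemma subgrad_step_progress:
  fixes Q :: "'a::euclidean_space set"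
  assumes Q: "closed Q" "convex Q" and sub: "is_subgradient f Q x g" and z: "z \<in> Q"
    and g: "g \<noteq> 0" and \<alpha>: "\<alpha> \<ge> 0"
  shows "(dist (subgrad_step Q x g \<alpha>) z)\<^sup>2 \<le> (dist x z)\<^sup>2 - 2 * \<alpha> * (f x - f z) + \<alpha>\<^sup>2 * (norm g)\<^sup>2"
proof -
  have "dist (subgrad_step Q x g \<alpha>) z = dist (closest_point Q (x - \<alpha> *\<^sub>R g)) (closest_point Q z)"
    using g z by (simp add: subgrad_step_def closest_point_self)
  also have "\<dots> \<le> dist (x - \<alpha> *\<^sub>R g) z"
    using Q z by (intro closest_point_lipschitz) auto
  finally have "(dist (subgrad_step Q x g \<alpha>) z)\<^sup>2 \<le> (norm (x - \<alpha> *\<^sub>R g - z))\<^sup>2"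
    by (simp add: dist_norm power_mono)
  also have "\<dots> = (dist x z)\<^sup>2 + 2 * \<alpha> * (g \<bullet> (z - x)) + \<alpha>\<^sup>2 * (norm g)\<^sup>2"
    unfolding dist_norm power2_norm_eq_inner
    by (simp add: inner_diff inner_commute algebra_simps power2_eq_square)
  also have "\<dots> \<le> (dist x z)\<^sup>2 - 2 * \<alpha> * (f x - f z) + \<alpha>\<^sup>2 * (norm g)\<^sup>2"
  proof -
    have "f x + g \<bullet> (z - x) \<le> f z" using sub z by (simp add: is_subgradient_def)
    then have "g \<bullet> (z - x) \<le> f z - f x" by simp
    from mult_left_mono[OF this, of "2 * \<alpha>"] \<alpha> show ?thesis by (simp add: algebra_simps)
  qed
  finally show ?thesis .
qed

lemma subgrad_step_in:
  assumes "closed Q" "x \<in> Q"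
  shows "subgrad_step Q x g \<alpha> \<in> Q"
  using assms by (auto simp: subgrad_step_def intro: closest_point_in_set)

section \<open>Length of one subgradient sequence\<close>

locale growth_problem =
  fixes Q :: "'a::euclidean_space set" and f :: "'a \<Rightarrow> real" and fstar fslb G M :: real
  assumes closed_Q: "closed Q" and convex_Q: "convex Q"
    and cont_f: "continuous_on Q f"
    and min_f: "is_min_value f Q fstar"
    and slb: "fslb < fstar"
    and growth: "\<And>x. x \<in> Q \<Longrightarrow> infdist x (opt_set f Q fstar) \<le> G * (f x - fslb)"
begin

lemma fstar_le: "x \<in> Q \<Longrightarrow> fstar \<le> f x"
  using min_f by (simp add: is_min_value_def)

lemma gap_pos: "x \<in> Q \<Longrightarrow> 0 < f x - fslb"
  using fstar_le slb by fastforce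

lemma closed_opt: "closed (opt_set f Q fstar)"
  unfolding opt_set_def
  using continuous_closed_preimage_constant[OF cont_f closed_Q, of fstar] by simp

lemma opt_nonempty: "opt_set f Q fstar \<noteq> {}"
  using min_f by (auto simp: opt_set_def is_min_value_def)

text \<open>Stated for an abstract sequence, so that it serves both step sizes. The decrease per
  step and the initial squared distance both scale with \<open>h0\<^sup>2\<close>, which therefore
  cancels.\<close>

lemma subgradient_sequence_length:
  fixes y s :: "nat \<Rightarrow> 'a"
  assumes y0: "y 0 \<in> Q" and h0: "h0 = f (y 0) - fslb" and F: "F > 0" and e: "eps' > 0"
    and e_def: "e = eps' / (1 + eps')"
    and sub: "\<And>j. j < k \<Longrightarrow> is_subgradient f Q (y j) (s j)"
    and M: "\<And>j. j < k \<Longrightarrow> norm (s j) \<le> M"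
    and large: "\<And>j. j < k \<Longrightarrow> (f (y j) - fslb) / h0 \<ge> 1 / F"
    and bad: "\<And>j. j < k \<Longrightarrow> \<not> (f (y j) - fstar) / (fstar - fslb) \<le> eps'"
    and step: "\<And>j. j < k \<Longrightarrow>
      y (Suc j) = subgrad_step Q (y j) (s j) (e * h0 / (F * (norm (s j))\<^sup>2))"
  shows "real k * e\<^sup>2 \<le> (F * M * G)\<^sup>2"
proof -
  have h0_pos: "h0 > 0" using gap_pos[OF y0] h0 by simp
  have e_pos: "e > 0" using e by (simp add: e_def)
  \<comment> \<open>The minimizer nearest to the starting point is the reference for all steps, so
    \<open>growth\<close> is applied only once.\<close>
  obtain z where z: "z \<in> opt_set f Q fstar" and dz: "infdist (y 0) (opt_set f Q fstar) = dist (y 0) z"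
    using infdist_attains_inf[OF closed_opt opt_nonempty] by blast
  have zQ: "z \<in> Q" and fz: "f z = fstar" using z by (auto simp: opt_set_def)
  define a where "a = e * h0 / F"
  have a: "a > 0" using e_pos h0_pos F by (simp add: a_def)
  \<comment> \<open>The potential is multiplied by \<open>M\<^sup>2\<close> instead of divided, so
    \<open>M = 0\<close> needs no separate treatment.\<close>
  have "M\<^sup>2 * (dist (y j) z)\<^sup>2 + real j * a\<^sup>2 \<le> M\<^sup>2 * (dist (y 0) z)\<^sup>2" if "j \<le> k" for j
    using that
  proof (induction j)
    case (Suc j)
    then have j: "j < k" by simp
    define n where "n = norm (s j)"
    have yQ: "y j \<in> Q" using sub[OF j] by (simp add: is_subgradient_def)
    have hstar: "fstar - fslb > 0" using slb by simp
    have "f (y j) - fstar > eps' * (fstar - fslb)"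
      using bad[OF j] hstar by (simp add: not_le pos_less_divide_eq)
    \<comment> \<open>An error above \<open>eps'\<close> relative to \<open>fstar - fslb\<close> is
      an error above \<open>e\<close> relative to \<open>f (y j) - fslb\<close>; this explains the
      form of \<open>e\<close>.\<close>
    then have "(1 + eps') * (f (y j) - fstar) > eps' * (f (y j) - fslb)"
      by (simp add: algebra_simps)
    then have "f (y j) - fstar > e * (f (y j) - fslb)"
      using e by (simp add: e_def field_simps)
    moreover have "e * (f (y j) - fslb) \<ge> a"
    proof -
      have "h0 / F \<le> f (y j) - fslb" using large[OF j] h0_pos F by (simp add: field_simps)
      from mult_left_mono[OF this, of e] e_pos show ?thesis by (simp add: a_def)
    qed
    ultimately have \<delta>: "f (y j) - f z \<ge> a" using fz by simp
    have s0: "s j \<noteq> 0"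
    proof
      assume "s j = 0"
      then have "f z \<ge> f (y j)" using sub[OF j] zQ by (simp add: is_subgradient_def)
      then show False using \<delta> a by simp
    qed
    then have n: "n > 0" by (simp add: n_def)
    have "(dist (y (Suc j)) z)\<^sup>2
        \<le> (dist (y j) z)\<^sup>2 - 2 * (a / n\<^sup>2) * (f (y j) - f z) + (a / n\<^sup>2)\<^sup>2 * n\<^sup>2"
    proof -
      have "y (Suc j) = subgrad_step Q (y j) (s j) (a / n\<^sup>2)"
        by (simp add: step[OF j] a_def n_def)
      then show ?thesis
        using subgrad_step_progress[OF closed_Q convex_Q sub[OF j] zQ s0, of "a / n\<^sup>2"] a
        by (simp add: n_def)
    qed
    \<comment> \<open>The step size \<open>a / n\<^sup>2\<close> is tuned to the guaranteed error
      \<open>a\<close>: the linear term outweighs the quadratic one by a factor of two.\<close>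
    also have "\<dots> \<le> (dist (y j) z)\<^sup>2 - 2 * (a / n\<^sup>2) * a + (a / n\<^sup>2)\<^sup>2 * n\<^sup>2"
      using mult_left_mono[OF \<delta>, of "2 * (a / n\<^sup>2)"] a by simp
    also have "\<dots> = (dist (y j) z)\<^sup>2 - a\<^sup>2 / n\<^sup>2"
      using n by (simp add: field_simps power2_eq_square)
    finally have "M\<^sup>2 * (dist (y (Suc j)) z)\<^sup>2 \<le> M\<^sup>2 * ((dist (y j) z)\<^sup>2 - a\<^sup>2 / n\<^sup>2)"
      by (simp add: mult_left_mono)
    moreover have "M\<^sup>2 * (a\<^sup>2 / n\<^sup>2) \<ge> a\<^sup>2"
    proof -
      have "n\<^sup>2 \<le> M\<^sup>2" using M[OF j] n by (simp add: n_def power_mono)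
      from mult_right_mono[OF this, of "a\<^sup>2"] show ?thesis using n by (simp add: field_simps)
    qed
    ultimately show ?case using Suc by (simp add: algebra_simps)
  qed simp
  from this[of k] have "real k * a\<^sup>2 \<le> M\<^sup>2 * (dist (y 0) z)\<^sup>2"
    using zero_le_square[of "M * dist (y k) z"] by (simp add: power2_eq_square algebra_simps)
  also have "\<dots> \<le> M\<^sup>2 * (G * h0)\<^sup>2"
    using growth[OF y0] dz h0 by (intro mult_left_mono power_mono) auto
  finally have "(real k * e\<^sup>2) * h0\<^sup>2 \<le> (F * M * G)\<^sup>2 * h0\<^sup>2"
    using F by (simp add: a_def power_mult_distrib power_divide field_simps)
  then show ?thesis using h0_pos by simp
qed

end

section \<open>Restarts\<close>

text \<open>The threshold is fixed to \<open>1 / F\<close>: continuing then guarantees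
  \<open>f - fslb\<close> at least \<open>h0 / F\<close>, the level for which the step sizes are
  scaled.\<close>

locale restarted_run = growth_problem Q f fstar fslb G M
  for Q :: "'a::euclidean_space set" and f fstar fslb G M +
  fixes F eps' epsb' :: real and x0 :: 'a and x xb g gb :: "nat \<Rightarrow> nat \<Rightarrow> 'a" and K :: "nat \<Rightarrow> enat"
  assumes run: "is_run f Q fslb (1 / F) F eps' epsb' x0 x xb g gb K"
    and F: "F > 1" and eps': "eps' > 0" and epsb': "epsb' > 0" and x0: "x0 \<in> Q"
    and bounded: "\<And>i j. step_performed K i j \<Longrightarrow> norm (g i j) \<le> M \<and> norm (gb i j) \<le> M"
begin

definition eps where "eps = eps' / (1 + eps')"
definition epsb where "epsb = epsb' / (1 + epsb')"

definition accurate :: "real \<Rightarrow> 'a \<Rightarrow> bool" where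
  "accurate \<delta> y \<longleftrightarrow> (f y - fstar) / (fstar - fslb) \<le> \<delta>"

abbreviation gap :: "nat \<Rightarrow> real" where "gap i \<equiv> f (x i 0) - fslb"

lemma run_start: "x 1 0 = x0" "xb 1 0 = x0"
  using run by (simp_all add: is_run_def Let_def)

lemma run_step:
  assumes "step_performed K i j"
  shows "continues f fslb (1 / F) x xb i j"
    and "is_subgradient f Q (x i j) (g i j)" and "is_subgradient f Q (xb i j) (gb i j)"
    and "x i (Suc j) = subgrad_step Q (x i j) (g i j) (eps * gap i / (F * (norm (g i j))\<^sup>2))"
    and "xb i (Suc j) = subgrad_step Q (xb i j) (gb i j)
           (epsb * (f (xb i 0) - fslb) / (F * (norm (gb i j))\<^sup>2))"
  using run assms by (simp_all add: is_run_def Let_def eps_def epsb_def)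

lemma run_restart:
  assumes "outer_started K i" "K i = enat k"
  shows "\<not> continues f fslb (1 / F) x xb i k"
    and "x (Suc i) 0 = (if (f (x i k) - fslb) / gap i < 1 / F then x i k else xb i k)"
    and "xb (Suc i) 0 = x (Suc i) 0"
  using run assms by (auto simp: is_run_def Let_def)

lemma outer_started_prev:
  assumes "outer_started K (Suc i)" "i \<ge> 1"
  shows "outer_started K i" and "\<exists>k. K i = enat k"
  using assms by (auto simp: outer_started_def)

lemma outer_started_le: "outer_started K i \<Longrightarrow> 1 \<le> i' \<Longrightarrow> i' \<le> i \<Longrightarrow> outer_started K i'"
  by (auto simp: outer_started_def)

lemma run_in_if_start_in:
  assumes "x i 0 \<in> Q" "xb i 0 \<in> Q" "point_reached K i j"
  shows "x i j \<in> Q \<and> xb i j \<in> Q"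
  using assms(3)
proof (induction j)
  case (Suc j)
  have s: "step_performed K i j" and "point_reached K i j"
    using Suc.prems Suc_ile_eq order.strict_implies_order
    by (auto simp: point_reached_def step_performed_def)
  then show ?case using Suc.IH subgrad_step_in[OF closed_Q] run_step(4,5)[OF s] by simp
qed (use assms in simp)

text \<open>The equality of the two starting points is carried along because the step sizes of both
  sequences must refer to the same \<open>gap i\<close>.\<close>

lemma start_in: "outer_started K i \<Longrightarrow> x i 0 \<in> Q \<and> xb i 0 = x i 0"
proof (induction i)
  case (Suc i)
  show ?case
  proof (cases "i = 0")
    case False
    then obtain k where o: "outer_started K i" and k: "K i = enat k"
      using outer_started_prev[OF Suc.prems] by auto
    have "x i k \<in> Q \<and> xb i k \<in> Q"
      using run_in_if_start_in[of i k] Suc.IH[OF o] o k by (simp add: point_reached_def)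
    then show ?thesis using run_restart[OF o k] by simp
  qed (use run_start x0 in simp)
qed (simp add: outer_started_def)

section \<open>Decrease of the gap over restarts\<close>

lemma gap_ge: "outer_started K i \<Longrightarrow> fstar - fslb \<le> gap i"
  using start_in fstar_le by simp

text \<open>When \<open>continues\<close> fails, at least one ratio is below \<open>1 / F\<close>,
  and the restart rule selects a point with such a ratio.\<close>

lemma gap_restart:
  assumes "outer_started K (Suc i)" "i \<ge> 1"
  shows "gap (Suc i) * F \<le> gap i"
proof -
  obtain k where o: "outer_started K i" and k: "K i = enat k"
    using outer_started_prev[OF assms] by auto
  have "(f (x (Suc i) 0) - fslb) / gap i < 1 / F"
    using run_restart[OF o k] by (auto simp: continues_def)
  moreover have "gap i > 0" using start_in[OF o] gap_pos by simp
  ultimately show ?thesis using F by (simp add: field_simps)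
qed

lemma gap_restarts:
  assumes "outer_started K (i + n)" "i \<ge> 1"
  shows "gap (i + n) * F ^ n \<le> gap i"
  using assms(1)
proof (induction n)
  case (Suc n)
  have "outer_started K (i + n)" using Suc.prems outer_started_le assms(2) by force
  then have "gap (i + n) * F ^ n \<le> gap i" by (rule Suc.IH)
  moreover have "gap (Suc (i + n)) * F * F ^ n \<le> gap (i + n) * F ^ n"
    using gap_restart[of "i + n"] Suc.prems assms(2) F by (intro mult_right_mono) auto
  ultimately show ?case by (simp add: mult.assoc)
qed simp

section \<open>Counting inner iterations and iterates\<close>

lemma inner_length:
  assumes o: "outer_started K i" and k: "enat k \<le> K i"
    and bad: "\<And>j. j < k \<Longrightarrow> \<not> accurate eps' (x i j)"
  shows "real k * eps\<^sup>2 \<le> (F * M * G)\<^sup>2"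
proof -
  have s: "step_performed K i j" if "j < k" for j
    using that o k less_le_trans[of "enat j" "enat k" "K i"] by (simp add: step_performed_def)
  show ?thesis
    by (rule subgradient_sequence_length[of "x i" "gap i" F eps' eps k "g i"])
      (use start_in[OF o] F eps' bad run_step[OF s] bounded[OF s] in
        \<open>auto simp: eps_def accurate_def continues_def\<close>)
qed

lemma inner_length_bar:
  assumes o: "outer_started K i" and k: "enat k \<le> K i"
    and bad: "\<And>j. j < k \<Longrightarrow> \<not> accurate epsb' (xb i j)"
  shows "real k * epsb\<^sup>2 \<le> (F * M * G)\<^sup>2"
proof -
  have s: "step_performed K i j" if "j < k" for j
    using that o k less_le_trans[of "enat j" "enat k" "K i"] by (simp add: step_performed_def)
  show ?thesis
    by (rule subgradient_sequence_length[of "xb i" "gap i" F epsb' epsb k "gb i"])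
      (use start_in[OF o] F epsb' bad run_step[OF s] bounded[OF s] in
        \<open>auto simp: epsb_def accurate_def continues_def\<close>)
qed

text \<open>The outer iterations are split at an index \<open>q\<close>. Those before
  \<open>q\<close> are charged at the rate of \<open>epsb\<close> and are logarithmically many;
  those from \<open>q\<close> to \<open>i\<close> are charged at the rate of \<open>eps\<close> and
  number at most \<open>m\<close>.\<close>

lemma iterates_before_accurate:
  assumes r: "point_reached K i j"
    and bad: "\<And>i' j'. step_performed K i' j' \<Longrightarrow> i' < i \<or> i' = i \<and> j' < j \<Longrightarrow> \<not> accurate eps' (x i' j')"
    and m: "(1 + epsb') * F < F ^ m"
  shows "real (iterates_computed K i j)
    \<le> 2 * (F * M * G)\<^sup>2 * (ln (gap 1 / (fstar - fslb)) / (ln F * epsb\<^sup>2) + real m / eps\<^sup>2)"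
proof -
  \<comment> \<open>The current outer iteration is cut off at \<open>j\<close>, since it may be
    unfinished or even infinite.\<close>
  define k where "k i' = (if i' = i then j else the_enat (K i'))" for i'
  define C where "C = (F * M * G)\<^sup>2"
  have C: "C \<ge> 0" by (simp add: C_def)
  have e: "eps > 0" "epsb > 0" using eps' epsb' by (simp_all add: eps_def epsb_def)
  have o: "outer_started K i" and i: "i \<ge> 1" using r by (auto simp: point_reached_def outer_started_def)
  have ol: "outer_started K i'" if "i' \<in> {1..i}" for i'
    using outer_started_le[OF o] that by simp
  have kK: "enat (k i') \<le> K i'" if "i' \<in> {1..i}" for i'
  proof (cases "i' = i")
    case False
    then have "K i' \<noteq> \<infinity>" using o that by (auto simp: outer_started_def)
    then show ?thesis using False by (auto simp: k_def)
  qed (use r in \<open>simp add: k_def point_reached_def\<close>)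
  have performed: "step_performed K i' j'" if "i' \<in> {1..i}" "j' < k i'" for i' j'
    using that ol[of i'] kK[of i'] less_le_trans[of "enat j'" "enat (k i')" "K i'"]
    by (simp add: step_performed_def)
  have len: "real (k i') \<le> C / eps\<^sup>2" if i': "i' \<in> {1..i}" for i'
  proof -
    have "real (k i') * eps\<^sup>2 \<le> C"
      unfolding C_def
    proof (rule inner_length[OF ol[OF i'] kK[OF i']])
      show "\<not> accurate eps' (x i' j')" if "j' < k i'" for j'
        using bad[OF performed[OF i' that]] i' that by (auto simp: k_def split: if_splits)
    qed
    then show ?thesis using e by (simp add: field_simps)
  qed
  define far where "far i' \<longleftrightarrow> (\<forall>j'<k i'. \<not> accurate epsb' (xb i' j'))" for i'
  have lenb: "real (k i') \<le> C / epsb\<^sup>2" if i': "i' \<in> {1..i}" and "far i'" for i'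
    using inner_length_bar[OF ol[OF i'] kK[OF i']] that e by (simp add: far_def C_def field_simps)
  \<comment> \<open>\<open>q\<close> is the first outer iteration whose second sequence gets
    \<open>epsb'\<close>-accurate at a counted step, or \<open>i\<close> if there is none.\<close>
  obtain q where q: "q \<in> {1..i}" and far_q: "\<And>i'. i' \<in> {1..<q} \<Longrightarrow> far i'" and iq: "i < q + m"
  proof (cases "\<exists>i'\<in>{1..i}. \<not> far i'")
    case False
    have "m \<noteq> 0"
    proof
      assume "m = 0"
      then show False using m F epsb' mult_mono[of 1 "1 + epsb'" 1 F] by simp
    qed
    then show ?thesis using False i that[of i] by simp
  next
    case True
    define q where "q = (LEAST i'. i' \<in> {1..i} \<and> \<not> far i')"
    from True have q: "q \<in> {1..i}" "\<not> far q"
      unfolding q_def by (metis (mono_tags, lifting) LeastI_ex)+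
    have fq: "far i'" if "i' \<in> {1..<q}" for i'
      using not_less_Least[of i' "\<lambda>i'. i' \<in> {1..i} \<and> \<not> far i'", folded q_def] that q(1) by auto
    obtain j' where j': "j' < k q" "accurate epsb' (xb q j')" using q(2) by (auto simp: far_def)
    have hs: "fstar - fslb > 0" using slb by simp
    have gq: "gap q > 0" using start_in[OF ol[OF q(1)]] gap_pos by simp
    have "f (xb q j') - fslb \<le> (1 + epsb') * (fstar - fslb)"
      using j'(2) hs by (simp add: accurate_def field_simps)
    moreover have "gap q \<le> F * (f (xb q j') - fslb)"
      using run_step(1)[OF performed[OF q(1) j'(1)]] F gq by (simp add: continues_def field_simps)
    moreover have "F * (f (xb q j') - fslb) \<le> F * ((1 + epsb') * (fstar - fslb))"
      using calculation(1) F by (intro mult_left_mono) auto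
    \<comment> \<open>The algorithm continued at the accurate point, so \<open>gap q\<close> is at
      most \<open>F\<close> times the value of \<open>f - fslb\<close> there.\<close>
    ultimately have gap_le: "gap q \<le> (1 + epsb') * F * (fstar - fslb)"
      by (simp add: mult.assoc mult.left_commute)
    have "i < q + m"
    proof (rule ccontr)
      assume "\<not> i < q + m"
      then have oq: "outer_started K (q + m)" using ol[of "q + m"] q(1) by simp
      \<comment> \<open>Another \<open>m\<close> restarts would push the gap below its minimum
        \<open>fstar - fslb\<close>.\<close>
      have "F ^ m * (fstar - fslb) \<le> gap (q + m) * F ^ m"
        using gap_ge[OF oq] F by (simp add: mult.commute)
      also have "\<dots> \<le> gap q" using gap_restarts[OF oq] q(1) by simp
      also note gap_le
      finally show False using m hs by simp
    qed
    then show ?thesis using that q(1) fq by blast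
  qed
  \<comment> \<open>Only \<open>q - 1\<close> restarts precede outer iteration \<open>q\<close>; the
    room between \<open>gap 1\<close> and \<open>fstar - fslb\<close> limits their number.\<close>
  have "F ^ (q - 1) * (fstar - fslb) \<le> gap q * F ^ (q - 1)"
    using gap_ge[OF ol[OF q]] F by (simp add: mult.commute)
  also have "\<dots> \<le> gap 1" using gap_restarts[of 1 "q - 1"] ol[OF q] q by simp
  finally have "F ^ (q - 1) \<le> gap 1 / (fstar - fslb)" using slb by (simp add: field_simps)
  then have "ln (F ^ (q - 1)) \<le> ln (gap 1 / (fstar - fslb))"
    using F by (subst ln_le_cancel_iff) (auto intro: less_le_trans[of 0 "F ^ (q - 1)"])
  then have q_le: "real (q - 1) \<le> ln (gap 1 / (fstar - fslb)) / ln F"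
    using F by (simp add: ln_realpow field_simps)
  have "iterates_computed K i j = (\<Sum>i'\<in>{1..<i}. 2 * k i') + 2 * k i"
    unfolding iterates_computed_def by (simp add: k_def)
  also have "\<dots> = 2 * (\<Sum>i'\<in>{1..<Suc i}. k i')"
    using i by (simp add: sum_distrib_left)
  also have "(\<Sum>i'\<in>{1..<Suc i}. k i') = (\<Sum>i'\<in>{1..<q}. k i') + (\<Sum>i'\<in>{q..<Suc i}. k i')"
    using q by (intro sum.atLeastLessThan_concat[symmetric]) auto
  finally have "real (iterates_computed K i j)
      = 2 * ((\<Sum>i'\<in>{1..<q}. real (k i')) + (\<Sum>i'\<in>{q..<Suc i}. real (k i')))"
    by simp
  moreover have "(\<Sum>i'\<in>{1..<q}. real (k i')) \<le> real (q - 1) * (C / epsb\<^sup>2)"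
    using sum_bounded_above[of "{1..<q}" "\<lambda>i'. real (k i')" "C / epsb\<^sup>2"] lenb far_q q by simp
  moreover have "real (q - 1) * (C / epsb\<^sup>2) \<le> ln (gap 1 / (fstar - fslb)) / ln F * (C / epsb\<^sup>2)"
    using q_le C by (intro mult_right_mono) auto
  moreover have "(\<Sum>i'\<in>{q..<Suc i}. real (k i')) \<le> real (Suc i - q) * (C / eps\<^sup>2)"
    using sum_bounded_above[of "{q..<Suc i}" "\<lambda>i'. real (k i')" "C / eps\<^sup>2"] len q by simp
  moreover have "real (Suc i - q) * (C / eps\<^sup>2) \<le> real m * (C / eps\<^sup>2)"
    using iq C by (intro mult_right_mono) auto
  ultimately have "real (iterates_computed K i j)
      \<le> 2 * (ln (gap 1 / (fstar - fslb)) / ln F * (C / epsb\<^sup>2) + real m * (C / eps\<^sup>2))"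
    by argo
  also have "\<dots> = 2 * C * (ln (gap 1 / (fstar - fslb)) / (ln F * epsb\<^sup>2) + real m / eps\<^sup>2)"
    by (simp add: algebra_simps)
  finally show ?thesis by (simp add: C_def)
qed

text \<open>Without an accurate iterate, either all outer iterations end and the gap shrinks
  geometrically below \<open>fstar - fslb\<close>, or one of them is infinite although its length is
  bounded.\<close>

lemma accurate_reached:
  assumes m: "(1 + epsb') * F < F ^ m"
  shows "\<exists>i j. point_reached K i j \<and> accurate eps' (x i j)"
proof (rule ccontr)
  assume none: "\<not> ?thesis"
  have bad: "\<not> accurate eps' (x i j)" if "step_performed K i j" for i j
    using that none by (auto simp: point_reached_def step_performed_def)
  show False
  proof (cases "\<forall>i\<ge>1. K i \<noteq> \<infinity>")
    case True
    then have o: "outer_started K i" if "i \<ge> 1" for i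
      using that by (auto simp: outer_started_def)
    obtain n where n: "gap 1 / (fstar - fslb) < F ^ n"
      using real_arch_pow[OF F] by blast
    have "(fstar - fslb) * F ^ n \<le> gap (1 + n) * F ^ n"
      using gap_ge[OF o, of "1 + n"] F by (intro mult_right_mono) auto
    also have "\<dots> \<le> gap 1" using gap_restarts[OF o, of 1 n] by simp
    finally show False using n slb by (simp add: field_simps)
  next
    case False
    \<comment> \<open>The first infinite outer iteration is taken because it is actually
      started.\<close>
    define i where "i = (LEAST i. i \<ge> 1 \<and> K i = \<infinity>)"
    from False have "\<exists>i. i \<ge> 1 \<and> K i = \<infinity>" by simp
    then have i: "i \<ge> 1 \<and> K i = \<infinity>"
      unfolding i_def by (rule LeastI_ex)
    have "outer_started K i"
      using i not_less_Least[of _ "\<lambda>i. i \<ge> 1 \<and> K i = \<infinity>", folded i_def]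
      by (auto simp: outer_started_def)
    then have "point_reached K i j" for j using i by (simp add: point_reached_def)
    \<comment> \<open>The bound does not depend on \<open>j\<close>, so a single \<open>N\<close>
      serves for all \<open>j\<close>.\<close>
    from iterates_before_accurate[OF this bad m] obtain N
      where N: "\<And>j. real (iterates_computed K i j) \<le> N" by blast
    obtain j :: nat where "real j > N" using reals_Archimedean2 by blast
    moreover have "j \<le> iterates_computed K i j" by (simp add: iterates_computed_def)
    ultimately show False using N[of j] by simp
  qed
qed

text \<open>The lexicographically first accurate pair has only inaccurate \<open>x\<close>-iterates
  before it, as \<open>iterates_before_accurate\<close> demands.\<close>

lemma accurate_within:
  assumes m: "(1 + epsb') * F < F ^ m"
  shows "\<exists>i j. point_reached K i j \<and> accurate eps' (x i j) \<and> real (iterates_computed K i j)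
    \<le> 2 * (F * M * G)\<^sup>2 * (ln (gap 1 / (fstar - fslb)) / (ln F * epsb\<^sup>2) + real m / eps\<^sup>2)"
proof -
  define P where "P i j \<longleftrightarrow> point_reached K i j \<and> accurate eps' (x i j)" for i j
  define i where "i = (LEAST i. \<exists>j. P i j)"
  define j where "j = (LEAST j. P i j)"
  have "\<exists>i j. P i j" using accurate_reached[OF m] by (simp add: P_def)
  then have "\<exists>j. P i j" unfolding i_def by (rule LeastI_ex)
  then have Pij: "P i j" unfolding j_def by (rule LeastI_ex)
  have "\<not> P i' j'" if "i' < i \<or> i' = i \<and> j' < j" for i' j'
    using that not_less_Least[of i' "\<lambda>i. \<exists>j. P i j", folded i_def] not_less_Least[of j' "P i", folded j_def]
    by blast
  moreover have "point_reached K i' j'" if "step_performed K i' j'" for i' j'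
    using that by (auto simp: point_reached_def step_performed_def)
  ultimately show ?thesis
    using iterates_before_accurate[OF _ _ m, of i j] Pij unfolding P_def by blast
qed

end

section \<open>Numerical constants\<close>

theorem theorem3p1:
  fixes Q Qhat :: "(real ^ 'n) set"
    and f :: "real ^ 'n \<Rightarrow> real"
    and fstar fslb M G eps' :: real
    and x0 :: "real ^ 'n"
    and x xb g gb :: "nat \<Rightarrow> nat \<Rightarrow> real ^ 'n"
    and K :: "nat \<Rightarrow> enat"
  assumes "closed Q" and "convex Q" and "convex_on Q f"
    and "is_min_value f Q fstar"
    and "fslb < fstar"
    and "bdd_above (growth_ratios f Q fstar fslb)"
    and "G = growth_const f Q fstar fslb"
    and "rel_open Qhat" and "Q \<subseteq> Qhat" and "M-lipschitz_on Qhat f"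
    and "x0 \<in> Q" and "eps' > 0"
    and "is_run f Q fslb (1 / sqrt (exp 1)) (sqrt (exp 1)) eps' 0.9 x0 x xb g gb K"
    and "\<And>i j. step_performed K i j \<Longrightarrow> norm (g i j) \<le> M \<and> norm (gb i j) \<le> M"
  shows "\<exists>i j. point_reached K i j \<and>
           real (iterates_computed K i j) \<le>
             18 * M\<^sup>2 * G\<^sup>2 * (2.7 * ln (1 + (f x0 - fstar) / (fstar - fslb)) + ((1 + eps') / eps')\<^sup>2) \<and>
           (f (x i j) - fstar) / (fstar - fslb) \<le> eps'"
proof -
  define F :: real where "F = sqrt (exp 1)"
  have F2: "F\<^sup>2 = exp 1" by (simp add: F_def)
  have e: "exp 1 < (2.72 :: real)" using e_less_272 by simp
  have e': "exp 1 > (1.9 :: real)" using exp_ge_add_one_self[of "1 :: real"] by simp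
  have F1: "F > 1" by (simp add: F_def)
  interpret restarted_run Q f fstar fslb G M F eps' "0.9" x0 x xb g gb K
  proof
    \<comment> \<open>Convexity alone would not give continuity at the relative boundary of
      \<open>Q\<close>; the Lipschitz bound does.\<close>
    have "M-lipschitz_on Q f" using assms lipschitz_on_subset by blast
    then show "continuous_on Q f" by (rule lipschitz_on_continuous_on)
    show "infdist y (opt_set f Q fstar) \<le> G * (f y - fslb)" if "y \<in> Q" for y
    proof -
      have "infdist y (opt_set f Q fstar) / (f y - fslb) \<le> G"
        unfolding \<open>G = _\<close> growth_const_def
        using that assms(6) by (intro cSup_upper) (auto simp: growth_ratios_def)
      moreover have "f y - fslb > 0" using assms(4,5) that by (fastforce simp: is_min_value_def)
      ultimately show ?thesis by (simp add: field_simps)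
    qed
  qed (use assms F1 in \<open>auto simp: F_def\<close>)
  \<comment> \<open>\<open>m = 3\<close> works because \<open>F ^ 3 = exp 1 * F\<close>;
    \<open>m = 2\<close> would require \<open>sqrt (exp 1) > 1.9\<close>, which is false.\<close>
  have "(1 + 0.9) * F < F ^ 3"
    using e' F1 F2 by (simp add: power3_eq_cube power2_eq_square)
  from accurate_within[OF this] obtain i j where ij: "point_reached K i j" "accurate eps' (x i j)"
    and le: "real (iterates_computed K i j)
      \<le> 2 * (F * M * G)\<^sup>2 * (ln (gap 1 / (fstar - fslb)) / (ln F * epsb\<^sup>2) + real 3 / eps\<^sup>2)"
    by blast
  define L where "L = ln (1 + (f x0 - fstar) / (fstar - fslb))"
  define E where "E = ((1 + eps') / eps')\<^sup>2"
  define A where "A = M\<^sup>2 * G\<^sup>2"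
  have E: "1 / eps\<^sup>2 = E" by (simp add: E_def eps_def power_divide)
  have L: "ln (gap 1 / (fstar - fslb)) = L"
    using run_start(1) slb by (simp add: L_def field_simps)
  have L0: "L \<ge> 0"
    using fstar_le[OF \<open>x0 \<in> Q\<close>] slb by (simp add: L_def)
  have lnF: "ln F = 1 / 2" by (simp add: F_def ln_sqrt)
  \<comment> \<open>Here \<open>1444 / 81 = 4 * (19 / 9)\<^sup>2\<close>: one factor 2 counts both
    sequences, the other is \<open>1 / ln F\<close>, and \<open>epsb = 9 / 19\<close>.\<close>
  have "2 * (F * M * G)\<^sup>2 * (ln (gap 1 / (fstar - fslb)) / (ln F * epsb\<^sup>2) + real 3 / eps\<^sup>2)
      = A * (exp 1 * (1444 / 81) * L + 6 * exp 1 * E)"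
    unfolding L lnF E[symmetric]
    by (simp add: F2 A_def epsb_def power_mult_distrib power_divide field_simps)
  \<comment> \<open>The target is \<open>48.6 = 18 * 2.7\<close>; the bound
    \<open>exp 1 < 2.72\<close> leaves just enough room.\<close>
  also have "\<dots> \<le> A * (48.6 * L + 18 * E)"
  proof -
    have "exp 1 * (1444 / 81) * L \<le> 48.6 * L" using e L0 by (intro mult_right_mono) auto
    moreover have "6 * exp 1 * E \<le> 18 * E" using e by (intro mult_right_mono) (auto simp: E_def)
    ultimately show ?thesis by (intro mult_left_mono add_mono) (auto simp: A_def)
  qed
  also have "\<dots> = 18 * M\<^sup>2 * G\<^sup>2 * (2.7 * L + E)" by (simp add: A_def algebra_simps)
  finally have "real (iterates_computed K i j) \<le> 18 * M\<^sup>2 * G\<^sup>2 * (2.7 * L + E)"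
    using le by (rule order_trans[rotated])
  then show ?thesis using ij unfolding accurate_def L_def E_def by blast
qed

end
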